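(* Let $n\ge 1$, let $0<\rho<1$ be real and let $\beta\ge 1$ be an integer. If algorithm RRW is executed by $n$ stations on a multiple access channel without jamming and without collision detection, against any leaky-bucket adversary of type $(\rho,\beta)$, then in every round the total number of packets queued in the stations is at most $$\frac{2\rho}{1-\rho}\cdot n+\beta$$ and packet latency is at most $$\frac{2-\rho}{(1-\rho)^2}\cdot n+\frac{\beta}{1-\rho}.$$
   Context: Channel. There are $n$ stations with distinct names $0,1,\dots,n-1$ attached to a shared channel; $n$ and own names are known to the stations. Time is divided into synchronous rounds numbered from $0$; all stations start in round $0$ with empty queues. In each round each station either transmits one message (containing at most one packet) or pauses. A message is heard (by all stations) in a round iff it is the only message transmitted in that round. A round is void if no message is heard, silent if nobody transmits; without collision detection stations cannot tell silence from collision. All stations get the same feedback. Within a round the order is: transmissions, feedback, injection of new packets (enqueued into private unbounded FIFO queues), local state change. A packet is removed from its queue once heard, and never dropped before. Adversary of type $(\rho,\beta)$: in each contiguous segment of $t>0$ rounds it injects at most $\rho t+\beta$ packets, into arbitrary stations. Packet latency: an upper bound on the number of rounds a packet spends waiting, counted from the round of injection through the round in which it is heard, over all executions against such adversaries. Algorithm RRW (Round-Robin-Withholding): a conceptual token visits the stations in the cyclic order $0,1,\dots,n-1,0,\dots$, starting at station $0$ in round $0$. The station holding the token transmits packets from its queue, one per round, until its queue is empty (including packets injected while it holds the token); then it pauses, producing one silent round, which makes the token move to the next station. Stations without the token do not transmit. *)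

theory Defs
  imports Complex_Main
begin

text \<open>
  Packet contents are irrelevant, so an adversary is described by the numbers of packets it
  injects: \<open>adv t i\<close> is the number of packets injected in round \<open>t\<close> into station \<open>i\<close>. A packet is
  identified by its round and station of injection and an index among the packets injected there
  in that round. Stations are \<open>0, \<dots>, n - 1\<close>; values at names \<open>i \<ge> n\<close> are
  junk without influence on these stations.
\<close>

type_synonym injection = "nat \<Rightarrow> nat \<Rightarrow> nat"

datatype packet = Packet (injection_round: nat) (injection_station: nat) (injection_index: nat)

definition injected :: "injection \<Rightarrow> nat \<Rightarrow> nat \<Rightarrow> packet list" where
  "injected adv t i = map (Packet t i) [0..<adv t i]"

definition leaky_bucket :: "nat \<Rightarrow> real \<Rightarrow> nat \<Rightarrow> injection \<Rightarrow> bool" where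
  "leaky_bucket n \<rho> \<beta> adv \<longleftrightarrow>
     (\<forall>s. \<forall>t>0. real (\<Sum>r=s..<s+t. \<Sum>i<n. adv r i) \<le> \<rho> * real t + real \<beta>)"

text \<open>
  The feedback of the channel, common to all stations: the message heard, or \<open>None\<close> in a void
  round. As there is no collision detection, silence and collision both give \<open>None\<close>.
\<close>

definition channel_feedback :: "nat \<Rightarrow> (nat \<Rightarrow> 'm option) \<Rightarrow> 'm option" where
  "channel_feedback n tx =
     (if \<exists>!i. i < n \<and> tx i \<noteq> None then tx (THE i. i < n \<and> tx i \<noteq> None) else None)"

text \<open>
  The token of RRW is not an object on the channel: every station locally maintains the name of
  the station it takes to be the token holder, updating it from the channel feedback alone.
\<close>

datatype station = Station (token: nat) (queue: "packet list")

definition rrw_transmit :: "nat \<Rightarrow> station \<Rightarrow> packet option" where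
  "rrw_transmit i st =
     (if token st = i \<and> queue st \<noteq> [] then Some (hd (queue st)) else None)"

text \<open>
  \<open>rrw_update n i fb new st\<close> is the state of station \<open>i\<close> at the end of a round that it began in
  state \<open>st\<close>, with feedback \<open>fb\<close> and newly injected packets \<open>new\<close>. If \<open>i\<close> transmitted and the
  round was not void, then the message heard is the one of \<open>i\<close>, and its packet is dequeued.
\<close>

definition rrw_update ::
  "nat \<Rightarrow> nat \<Rightarrow> packet option \<Rightarrow> packet list \<Rightarrow> station \<Rightarrow> station" where
  "rrw_update n i fb new st =
     Station
       (if fb = None then (token st + 1) mod n else token st)
       ((if rrw_transmit i st \<noteq> None \<and> fb \<noteq> None then tl (queue st) else queue st) @ new)"

text \<open>
  \<open>rrw n adv t i\<close> is the state of station \<open>i\<close> at the beginning of round \<open>t\<close>; hence the state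
  after the injections of round \<open>t\<close> is \<open>rrw n adv (Suc t) i\<close>.
\<close>

primrec rrw :: "nat \<Rightarrow> injection \<Rightarrow> nat \<Rightarrow> nat \<Rightarrow> station" where
  "rrw n adv 0 = (\<lambda>i. Station 0 [])"
| "rrw n adv (Suc t) =
     (\<lambda>i. rrw_update n i
            (channel_feedback n (\<lambda>j. rrw_transmit j (rrw n adv t j)))
            (injected adv t i)
            (rrw n adv t i))"

definition rrw_heard :: "nat \<Rightarrow> injection \<Rightarrow> nat \<Rightarrow> packet option" where
  "rrw_heard n adv t = channel_feedback n (\<lambda>i. rrw_transmit i (rrw n adv t i))"

definition rrw_queued :: "nat \<Rightarrow> injection \<Rightarrow> nat \<Rightarrow> nat" where
  "rrw_queued n adv t = (\<Sum>i<n. length (queue (rrw n adv t i)))"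

text \<open>
  Every injected packet is eventually heard, and the rounds from the round of injection through
  the round in which it is heard, both included, number at most \<open>L\<close>.
\<close>

definition rrw_latency_at_most :: "nat \<Rightarrow> injection \<Rightarrow> real \<Rightarrow> bool" where
  "rrw_latency_at_most n adv L \<longleftrightarrow>
     (\<forall>t. \<forall>i<n. \<forall>p\<in>set (injected adv t i).
        \<exists>r\<ge>t. rrw_heard n adv r = Some p \<and> real (r - t + 1) \<le> L)"

end

theory Submission imports Defs begin

text \<open>
  Let \<open>E t\<close> be the backlog of a leaky bucket that is filled by the injections and drained at
  rate \<open>\<rho>\<close>; it stays between \<open>0\<close> and \<open>\<beta>\<close>. Passing from the queue total \<open>Q\<close> to \<open>x = Q - E\<close>
  charges the burst \<open>\<beta>\<close> only once: each round lowers \<open>x\<close> by at least \<open>1 - \<rho>\<close>, except that each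
  void round gives back \<open>1\<close>. During \<open>n\<close> void rounds the token visits and empties every station,
  so between rounds \<open>u\<close> and \<open>v\<close> that are \<open>n\<close> void rounds apart all \<open>Q u\<close> old packets are heard, and
  \<open>v - u \<ge> n + Q u\<close>. Hence \<open>x v \<le> \<rho> * x u + \<rho> * n\<close>, and \<open>x \<le> \<rho> * n / (1 - \<rho>)\<close> throughout. As
  a packet waits for at most \<open>n\<close> void rounds, the drift of \<open>x\<close> also bounds its latency. Both
  bounds obtained in this way are slightly stronger than the claimed ones.
\<close>

subsection \<open>Leaky buckets\<close>

text \<open>Lindley's recursion: the value at \<open>t\<close> is the largest excess of injections
  over \<rho> per round among all segments ending just before round \<open>t\<close>, the empty one
  included.\<close>

primrec bucket_backlog :: "real \<Rightarrow> (nat \<Rightarrow> nat) \<Rightarrow> nat \<Rightarrow> real" where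
  "bucket_backlog \<rho> a 0 = 0"
| "bucket_backlog \<rho> a (Suc t) = max 0 (bucket_backlog \<rho> a t + real (a t) - \<rho>)"

lemma bucket_backlog_nonneg: "0 \<le> bucket_backlog \<rho> a t"
  by (cases t) auto

text \<open>The witness \<open>s\<close> is the last time at which the maximum with 0 reset the
  backlog.\<close>

lemma bucket_backlog_attained:
  "\<exists>s\<le>t. bucket_backlog \<rho> a t = real (\<Sum>r=s..<t. a r) - \<rho> * real (t - s)"
proof (induction t)
  case 0
  show ?case by simp
next
  case (Suc t)
  then obtain s where s: "s \<le> t"
    "bucket_backlog \<rho> a t = real (\<Sum>r=s..<t. a r) - \<rho> * real (t - s)"
    by blast
  show ?case
  proof (cases "bucket_backlog \<rho> a t + real (a t) - \<rho> \<ge> 0")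
    case True
    then have "bucket_backlog \<rho> a (Suc t) = real (\<Sum>r=s..<Suc t. a r) - \<rho> * real (Suc t - s)"
      using s by (simp add: Suc_diff_le algebra_simps)
    with s(1) show ?thesis by (intro exI[of _ s]) simp
  next
    case False
    then show ?thesis by (intro exI[of _ "Suc t"]) simp
  qed
qed

lemma bucket_backlog_le:
  assumes "leaky_bucket n \<rho> \<beta> adv"
  shows "bucket_backlog \<rho> (\<lambda>t. \<Sum>i<n. adv t i) t \<le> real \<beta>"
proof -
  obtain s where s: "s \<le> t" "bucket_backlog \<rho> (\<lambda>t. \<Sum>i<n. adv t i) t =
      real (\<Sum>r=s..<t. \<Sum>i<n. adv r i) - \<rho> * real (t - s)"
    using bucket_backlog_attained by blast
  show ?thesis
  \<comment> \<open>\<open>leaky_bucket\<close> constrains nonempty segments only; on the empty one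
    the backlog is 0.\<close>
  proof (cases "s = t")
    case False
    with s(1) have "real (\<Sum>r=s..<s + (t - s). \<Sum>i<n. adv r i) \<le> \<rho> * real (t - s) + real \<beta>"
      using assms unfolding leaky_bucket_def by (metis le_neq_implies_less zero_less_diff)
    with s show ?thesis by simp
  qed (use s in simp)
qed

subsection \<open>Executions of RRW\<close>

text \<open>Exactly the void rounds move the token, so this count is the token position before
  reduction modulo \<open>n\<close>.\<close>

definition rrw_voids :: "nat \<Rightarrow> injection \<Rightarrow> nat \<Rightarrow> nat" where
  "rrw_voids n adv t = card {r. r < t \<and> rrw_heard n adv r = None}"

lemma rrw_voids_0 [simp]: "rrw_voids n adv 0 = 0"
  by (simp add: rrw_voids_def)

lemma rrw_voids_Suc [simp]:
  "rrw_voids n adv (Suc t) =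
     (if rrw_heard n adv t = None then Suc (rrw_voids n adv t) else rrw_voids n adv t)"
proof -
  have "{r. r < Suc t \<and> rrw_heard n adv r = None} =
      (if rrw_heard n adv t = None then insert t {r. r < t \<and> rrw_heard n adv r = None}
       else {r. r < t \<and> rrw_heard n adv r = None})"
    by (auto simp: less_Suc_eq)
  then show ?thesis by (simp add: rrw_voids_def)
qed

lemma rrw_voids_mono: "u \<le> v \<Longrightarrow> rrw_voids n adv u \<le> rrw_voids n adv v"
  by (rule lift_Suc_mono_le[of "rrw_voids n adv"]) auto

text \<open>A discrete intermediate value argument: the count grows in unit steps, and
  \<open>w\<close> is the round in which it leaves the value \<open>k\<close>, hence a void
  one.\<close>

lemma rrw_voids_attained:
  assumes "rrw_voids n adv u \<le> k" "k < rrw_voids n adv v"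
  obtains w where "u \<le> w" "w < v" "rrw_voids n adv w = k" "rrw_heard n adv w = None"
  using assms(2)
proof (induction v arbitrary: thesis)
  case 0
  then show ?case by simp
next
  case (Suc v)
  show ?case
  proof (cases "k < rrw_voids n adv v")
    case True
    with Suc.IH obtain w where
      "u \<le> w" "w < v" "rrw_voids n adv w = k" "rrw_heard n adv w = None"
      by blast
    then show ?thesis by (intro Suc.prems(1)) auto
  next
    case False
    with Suc.prems(2) have v: "rrw_voids n adv v = k" "rrw_heard n adv v = None"
      by (auto split: if_splits)
    moreover have "u \<le> v"
    proof (rule ccontr)
      assume "\<not> u \<le> v"
      then have "rrw_voids n adv (Suc v) \<le> rrw_voids n adv u"
        by (intro rrw_voids_mono) simp
      with assms(1) Suc.prems(2) show False by simp
    qed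
    ultimately show ?thesis by (intro Suc.prems(1)) auto
  qed
qed

lemma token_rrw: "n \<ge> 1 \<Longrightarrow> token (rrw n adv t i) = rrw_voids n adv t mod n"
  by (induction t) (simp_all add: rrw_update_def rrw_heard_def mod_Suc_eq)

text \<open>All stations agree on the token, so collisions never occur and a round is void exactly
  when the holder's queue is empty.\<close>

lemma rrw_heard_eq:
  fixes adv :: injection and t :: nat
  assumes "n \<ge> 1"
  defines "k \<equiv> rrw_voids n adv t mod n"
  shows "rrw_heard n adv t =
    (if queue (rrw n adv t k) = [] then None else Some (hd (queue (rrw n adv t k))))"
proof -
  have tx: "rrw_transmit i (rrw n adv t i) = (if i = k \<and> queue (rrw n adv t k) \<noteq> []
      then Some (hd (queue (rrw n adv t k))) else None)" for i
    using assms by (auto simp: rrw_transmit_def token_rrw)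
  have "k < n" using assms by simp
  then have "i < n \<and> i = k \<longleftrightarrow> i = k" for i by auto
  then show ?thesis
    by (auto simp: rrw_heard_def channel_feedback_def tx)
qed

lemma queue_rrw_Suc:
  assumes "n \<ge> 1"
  shows "queue (rrw n adv (Suc t) i) =
    (if i = rrw_voids n adv t mod n then tl (queue (rrw n adv t i)) else queue (rrw n adv t i))
      @ injected adv t i"
proof -
  let ?q = "queue (rrw n adv t i)"
  have "rrw_transmit i (rrw n adv t i) \<noteq> None \<and> rrw_heard n adv t \<noteq> None \<longleftrightarrow>
      i = rrw_voids n adv t mod n \<and> ?q \<noteq> []"
    using rrw_heard_eq[OF assms, of adv t] assms by (auto simp: rrw_transmit_def token_rrw)
  moreover have "queue (rrw n adv (Suc t) i) =
      (if rrw_transmit i (rrw n adv t i) \<noteq> None \<and> rrw_heard n adv t \<noteq> None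
       then tl ?q else ?q) @ injected adv t i"
    by (simp add: rrw_update_def rrw_heard_def)
  \<comment> \<open>In a void round the holder's queue is empty, and \<open>tl [] = []\<close> makes
    the uniform formula correct.\<close>
  ultimately show ?thesis by (cases ?q) auto
qed

declare rrw.simps(2) [simp del]

lemma rrw_queued_Suc:
  assumes "n \<ge> 1"
  shows "rrw_queued n adv (Suc t) + 1 =
    rrw_queued n adv t + (\<Sum>i<n. adv t i) + (if rrw_heard n adv t = None then 1 else 0)"
proof -
  define k where "k = rrw_voids n adv t mod n"
  define q where "q = (\<lambda>i. length (queue (rrw n adv t i)))"
  have k: "k \<in> {..<n}" using assms by (simp add: k_def)
  have "rrw_queued n adv (Suc t) = (\<Sum>i<n. (if i = k then q i - 1 else q i)) + (\<Sum>i<n. adv t i)"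
    unfolding rrw_queued_def sum.distrib[symmetric]
    by (intro sum.cong) (auto simp: queue_rrw_Suc[OF assms] k_def q_def injected_def)
  also have "(\<Sum>i<n. (if i = k then q i - 1 else q i)) = q k - 1 + (\<Sum>i\<in>{..<n} - {k}. q i)"
    using k by (subst sum.remove[OF _ k]) auto
  finally have 1: "rrw_queued n adv (Suc t) =
      q k - 1 + (\<Sum>i\<in>{..<n} - {k}. q i) + (\<Sum>i<n. adv t i)" .
  have 2: "rrw_queued n adv t = q k + (\<Sum>i\<in>{..<n} - {k}. q i)"
    unfolding rrw_queued_def q_def using k by (subst sum.remove[OF _ k]) auto
  have "rrw_heard n adv t = None \<longleftrightarrow> q k = 0"
    using rrw_heard_eq[OF assms, of adv t] by (auto simp: k_def q_def)
  with 1 2 show ?thesis by auto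
qed

lemma queue_empty_if_voids:
  assumes "n \<ge> 1" "i < n" "rrw_voids n adv u + n \<le> rrw_voids n adv v"
  obtains w where "u \<le> w" "w < v" "rrw_voids n adv w mod n = i" "queue (rrw n adv w i) = []"
proof -
  \<comment> \<open>The least number from \<open>rrw_voids n adv u\<close> on that is congruent to
    \<open>i\<close> modulo \<open>n\<close>; adding \<open>n\<close> keeps the subtraction from
    truncating.\<close>
  define k where "k = rrw_voids n adv u + (i + n - rrw_voids n adv u mod n) mod n"
  have "(i + n - rrw_voids n adv u mod n) mod n < n" using assms by simp
  then have "rrw_voids n adv u \<le> k" "k < rrw_voids n adv v"
    using assms(3) unfolding k_def by linarith+
  then obtain w where
    w: "u \<le> w" "w < v" "rrw_voids n adv w = k" "rrw_heard n adv w = None"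
    by (rule rrw_voids_attained)
  have "rrw_voids n adv u mod n \<le> n" using assms by simp
  have "k mod n = (rrw_voids n adv u mod n + (i + n - rrw_voids n adv u mod n)) mod n"
    unfolding k_def by (simp add: mod_simps)
  also have "\<dots> = (i + n) mod n"
    using \<open>rrw_voids n adv u mod n \<le> n\<close> by simp
  also have "\<dots> = i" using assms by simp
  finally have "k mod n = i" .
  with w rrw_heard_eq[OF assms(1), of adv w] show ?thesis
    by (intro that[of w]) (auto split: if_splits)
qed

lemma length_queue_growth:
  assumes "n \<ge> 1" "w \<le> v"
  shows "length (queue (rrw n adv v i)) \<le> length (queue (rrw n adv w i)) + (\<Sum>r=w..<v. adv r i)"
  using assms(2)
  by (induction v rule: dec_induct) (auto simp: queue_rrw_Suc[OF assms(1)] injected_def)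

text \<open>Each station was empty at some round between \<open>u\<close> and \<open>v\<close>, so
  whatever it holds at \<open>v\<close> was injected since \<open>u\<close>.\<close>

lemma rrw_queued_le_injected:
  assumes "n \<ge> 1" "rrw_voids n adv u + n \<le> rrw_voids n adv v"
  shows "rrw_queued n adv v \<le> (\<Sum>r=u..<v. \<Sum>i<n. adv r i)"
proof -
  have "length (queue (rrw n adv v i)) \<le> (\<Sum>r=u..<v. adv r i)" if i: "i < n" for i
  proof -
    obtain w where w: "u \<le> w" "w < v" "queue (rrw n adv w i) = []"
      using queue_empty_if_voids[OF assms(1) i assms(2)] by metis
    have "length (queue (rrw n adv v i)) \<le> (\<Sum>r=w..<v. adv r i)"
      using length_queue_growth[OF assms(1), of w v adv i] w by simp
    also have "\<dots> \<le> (\<Sum>r=u..<v. adv r i)"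
      using w by (intro sum_mono2) auto
    finally show ?thesis .
  qed
  then have "rrw_queued n adv v \<le> (\<Sum>i<n. \<Sum>r=u..<v. adv r i)"
    unfolding rrw_queued_def by (intro sum_mono) auto
  also have "\<dots> = (\<Sum>r=u..<v. \<Sum>i<n. adv r i)"
    by (rule sum.swap)
  finally show ?thesis .
qed

lemma rrw_queued_balance:
  assumes "n \<ge> 1" "u \<le> v"
  shows "rrw_queued n adv v + (v - u) + rrw_voids n adv u =
    rrw_queued n adv u + (\<Sum>r=u..<v. \<Sum>i<n. adv r i) + rrw_voids n adv v"
  using assms(2)
proof (induction v rule: dec_induct)
  case base
  show ?case by simp
next
  case (step v)
  then show ?case using rrw_queued_Suc[OF assms(1), of adv v]
    by (auto simp: Suc_diff_le split: if_splits)
qed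

text \<open>The packets left at \<open>v\<close> are at most those injected since \<open>u\<close>,
  so the injections cancel from the balance.\<close>

lemma elapsed_ge_voids_plus_queued:
  assumes "n \<ge> 1" "u \<le> v" "rrw_voids n adv v = rrw_voids n adv u + n"
  shows "n + rrw_queued n adv u \<le> v - u"
  using rrw_queued_balance[OF assms(1,2), of adv] rrw_queued_le_injected[of n adv u v] assms
  by simp

subsection \<open>Queue sizes\<close>

definition rrw_potential :: "nat \<Rightarrow> real \<Rightarrow> injection \<Rightarrow> nat \<Rightarrow> real" where
  "rrw_potential n \<rho> adv t =
     real (rrw_queued n adv t) - bucket_backlog \<rho> (\<lambda>r. \<Sum>i<n. adv r i) t"

lemma rrw_potential_drift:
  assumes "n \<ge> 1" "u \<le> v"
  shows "rrw_potential n \<rho> adv v + (1 - \<rho>) * real (v - u) + real (rrw_voids n adv u) \<le>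
    rrw_potential n \<rho> adv u + real (rrw_voids n adv v)"
  using assms(2)
proof (induction v rule: dec_induct)
  case base
  show ?case by simp
next
  case (step v)
  let ?a = "\<lambda>r. \<Sum>i<n. adv r i"
  have "rrw_queued n adv (Suc v) + 1 + rrw_voids n adv v =
      rrw_queued n adv v + ?a v + rrw_voids n adv (Suc v)"
    using rrw_queued_Suc[OF assms(1), of adv v] by simp
  then have "real (rrw_queued n adv (Suc v)) + 1 + real (rrw_voids n adv v) =
      real (rrw_queued n adv v) + real (?a v) + real (rrw_voids n adv (Suc v))"
    by (metis of_nat_add of_nat_1)
  \<comment> \<open>Dropping the maximum with 0 errs in the right direction, as the backlog enters
    the potential negatively.\<close>
  moreover have "bucket_backlog \<rho> ?a v + real (?a v) - \<rho> \<le> bucket_backlog \<rho> ?a (Suc v)"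
    by simp
  ultimately have "rrw_potential n \<rho> adv (Suc v) + (1 - \<rho>) + real (rrw_voids n adv v) \<le>
      rrw_potential n \<rho> adv v + real (rrw_voids n adv (Suc v))"
    unfolding rrw_potential_def by linarith
  with step show ?case
    by (simp add: Suc_diff_le algebra_simps)
qed

lemma rrw_voids_le: "rrw_voids n adv t \<le> t"
  by (induction t) auto

lemma rrw_potential_le:
  assumes "n \<ge> 1" "0 < \<rho>" "\<rho> < 1"
  shows "rrw_potential n \<rho> adv t \<le> \<rho> * real n / (1 - \<rho>)"
proof (induction t rule: less_induct)
  case (less t)
  let ?K = "\<rho> * real n / (1 - \<rho>)"
  \<comment> \<open>\<open>?K\<close> is the fixed point of the map taking \<open>x\<close> to
    \<open>\<rho> * x + \<rho> * n\<close>.\<close>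
  have K: "\<rho> * ?K + \<rho> * real n = ?K"
    using assms by (simp add: field_simps)
  show ?case
  proof (cases "rrw_voids n adv t \<le> n")
    case True
    have "rrw_potential n \<rho> adv 0 = 0"
      by (simp add: rrw_potential_def rrw_queued_def)
    then have "rrw_potential n \<rho> adv t \<le> real (rrw_voids n adv t) - (1 - \<rho>) * real t"
      using rrw_potential_drift[OF assms(1), of 0 t \<rho> adv] by simp
    also have "\<dots> \<le> real (rrw_voids n adv t) - (1 - \<rho>) * real (rrw_voids n adv t)"
      using assms rrw_voids_le[of n adv t] by (simp add: mult_left_mono)
    also have "\<dots> = \<rho> * real (rrw_voids n adv t)" by (simp add: algebra_simps)
    also have "\<dots> \<le> \<rho> * real n" using True assms by simp
    also have "\<dots> \<le> ?K"
      using K assms by (smt (verit) divide_nonneg_pos mult_nonneg_nonneg of_nat_0_le_iff)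
    finally show ?thesis .
  next
    case False
    with assms(1) have "rrw_voids n adv 0 \<le> rrw_voids n adv t - n"
      "rrw_voids n adv t - n < rrw_voids n adv t" by auto
    then obtain u where u: "u < t" "rrw_voids n adv u = rrw_voids n adv t - n"
      by (rule rrw_voids_attained)
    with False have voids: "rrw_voids n adv t = rrw_voids n adv u + n" by simp
    have "real n + real (rrw_queued n adv u) \<le> real (t - u)"
      using elapsed_ge_voids_plus_queued[OF assms(1) _ voids] u(1) by linarith
    then have "(1 - \<rho>) * (real n + real (rrw_queued n adv u)) \<le> (1 - \<rho>) * real (t - u)"
      using assms by (intro mult_left_mono) auto
    moreover have "rrw_potential n \<rho> adv t + (1 - \<rho>) * real (t - u) \<le>
        rrw_potential n \<rho> adv u + real n"
      using rrw_potential_drift[OF assms(1), of u t \<rho> adv] u(1) voids by simp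
    \<comment> \<open>The backlog is nonnegative, so the queue total can be replaced by the
      potential, which closes the recurrence.\<close>
    moreover have "(1 - \<rho>) * rrw_potential n \<rho> adv u \<le> (1 - \<rho>) * real (rrw_queued n adv u)"
      using assms bucket_backlog_nonneg by (simp add: rrw_potential_def)
    ultimately have "rrw_potential n \<rho> adv t \<le> \<rho> * rrw_potential n \<rho> adv u + \<rho> * real n"
      by (simp add: algebra_simps)
    also have "\<dots> \<le> \<rho> * ?K + \<rho> * real n"
      using less.IH[OF u(1)] assms(2) by (intro add_right_mono mult_left_mono) auto
    finally show ?thesis using K by simp
  qed
qed

subsection \<open>Packet latency\<close>

text \<open>Only the head of the holder's queue is ever removed, and it is the message
  heard.\<close>

lemma queued_until_heard:
  assumes "n \<ge> 1" "p \<in> set (injected adv t i)" "Suc t \<le> v"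
    and "\<And>r. t < r \<Longrightarrow> r < v \<Longrightarrow> rrw_heard n adv r \<noteq> Some p"
  shows "p \<in> set (queue (rrw n adv v i))"
  using assms(3,4)
proof (induction v rule: dec_induct)
  case base
  show ?case using assms(1,2) by (simp add: queue_rrw_Suc)
next
  case (step v)
  then have p: "p \<in> set (queue (rrw n adv v i))" "rrw_heard n adv v \<noteq> Some p"
    by auto
  then show ?case using rrw_heard_eq[OF assms(1), of adv v] assms(1)
    by (cases "queue (rrw n adv v i)") (auto simp: queue_rrw_Suc)
qed

lemma voids_while_queued:
  assumes "n \<ge> 1" "i < n" "p \<in> set (injected adv t i)" "Suc t \<le> v"
    and "\<And>r. t < r \<Longrightarrow> r < v \<Longrightarrow> rrw_heard n adv r \<noteq> Some p"
  shows "rrw_voids n adv v < rrw_voids n adv (Suc t) + n"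
proof (rule ccontr)
  assume "\<not> ?thesis"
  then have "rrw_voids n adv (Suc t) + n \<le> rrw_voids n adv v" by simp
  with assms(1,2) obtain w where w: "Suc t \<le> w" "w < v" "queue (rrw n adv w i) = []"
    by (rule queue_empty_if_voids)
  then have "p \<in> set (queue (rrw n adv w i))"
    using assms by (intro queued_until_heard) auto
  with w show False by simp
qed

text \<open>\<open>v\<close> need not be the round in which \<open>p\<close> is heard, so the bound
  serves twice: to refute that \<open>p\<close> is never heard, and to time its first
  hearing.\<close>

lemma waiting_time_le:
  assumes "n \<ge> 1" "0 < \<rho>" "\<rho> < 1" "leaky_bucket n \<rho> \<beta> adv"
    and "i < n" "p \<in> set (injected adv t i)" "t < v"
    and "\<And>r. t < r \<Longrightarrow> r < v \<Longrightarrow> rrw_heard n adv r \<noteq> Some p"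
  shows "real (v - t + 1) \<le> real n / (1 - \<rho>)\<^sup>2 + real \<beta> / (1 - \<rho>)"
proof -
  let ?E = "bucket_backlog \<rho> (\<lambda>r. \<Sum>i<n. adv r i)"
  have "rrw_voids n adv v < rrw_voids n adv (Suc t) + n"
    using assms(7,8) by (intro voids_while_queued[OF assms(1,5,6)]) auto
  \<comment> \<open>The strict inequality absorbs round \<open>t\<close>, which may itself be
    void.\<close>
  then have "rrw_voids n adv v \<le> rrw_voids n adv t + n"
    by (simp split: if_splits)
  then have "rrw_potential n \<rho> adv v + (1 - \<rho>) * real (v - t) \<le> rrw_potential n \<rho> adv t + real n"
    using rrw_potential_drift[of n t v \<rho> adv] assms(1,7) by simp
  \<comment> \<open>The packet \<open>p\<close>, still queued at the beginning of round
    \<open>v\<close>, contributes the 1 that pays for counting round \<open>v\<close>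
    itself.\<close>
  moreover have "1 \<le> real (rrw_queued n adv v)"
  proof -
    have "p \<in> set (queue (rrw n adv v i))"
      using assms by (intro queued_until_heard) auto
    then have "1 \<le> length (queue (rrw n adv v i))"
      by (cases "queue (rrw n adv v i)") auto
    also have "\<dots> \<le> rrw_queued n adv v"
      unfolding rrw_queued_def using assms(5) by (intro member_le_sum) auto
    finally show ?thesis by simp
  qed
  moreover have "?E v \<le> real \<beta>" using assms(4) by (rule bucket_backlog_le)
  moreover have "rrw_potential n \<rho> adv t \<le> \<rho> * real n / (1 - \<rho>)"
    using assms(1-3) by (rule rrw_potential_le)
  moreover have "\<rho> * real n / (1 - \<rho>) + real n = real n / (1 - \<rho>)"
    using assms(3) by (simp add: field_simps)
  ultimately have "(1 - \<rho>) * real (v - t) + 1 \<le> real n / (1 - \<rho>) + real \<beta>"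
    unfolding rrw_potential_def by linarith
  then have "real (v - t + 1) * (1 - \<rho>) \<le> real n / (1 - \<rho>) + real \<beta>"
    using assms(2) by (simp add: algebra_simps)
  then have "real (v - t + 1) \<le> (real n / (1 - \<rho>) + real \<beta>) / (1 - \<rho>)"
    using assms(3) by (simp add: pos_le_divide_eq)
  then show ?thesis by (simp add: add_divide_distrib power2_eq_square)
qed

lemma rrw_latency:
  assumes "n \<ge> 1" "0 < \<rho>" "\<rho> < 1" "leaky_bucket n \<rho> \<beta> adv"
  shows "rrw_latency_at_most n adv (real n / (1 - \<rho>)\<^sup>2 + real \<beta> / (1 - \<rho>))"
  unfolding rrw_latency_at_most_def
proof (intro allI impI ballI)
  fix t i p
  assume i: "i < n" and p: "p \<in> set (injected adv t i)"
  let ?L = "real n / (1 - \<rho>)\<^sup>2 + real \<beta> / (1 - \<rho>)"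
  let ?P = "\<lambda>r. t < r \<and> rrw_heard n adv r = Some p"
  have "\<exists>r. ?P r"
  proof (rule ccontr)
    assume never: "\<not> ?thesis"
    obtain N :: nat where N: "?L < real N" using reals_Archimedean2 by blast
    have "real (t + Suc N - t + 1) \<le> ?L"
      using never by (intro waiting_time_le[OF assms i p]) auto
    with N show False by simp
  qed
  \<comment> \<open>The first hearing is taken because \<open>waiting_time_le\<close> requires
    \<open>p\<close> to be unheard before.\<close>
  then obtain r where r: "?P r" "\<And>s. s < r \<Longrightarrow> \<not> ?P s"
    using exists_least_iff[of ?P] by metis
  then have "real (r - t + 1) \<le> ?L"
    by (intro waiting_time_le[OF assms i p]) blast+
  with r(1) show "\<exists>r\<ge>t. rrw_heard n adv r = Some p \<and> real (r - t + 1) \<le> ?L"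
    by (intro exI[of _ r]) simp
qed

theorem theorem2:
  fixes n \<beta> :: nat and \<rho> :: real and adv :: injection
  assumes "n \<ge> 1" and "0 < \<rho>" and "\<rho> < 1" and "\<beta> \<ge> 1"
    and "leaky_bucket n \<rho> \<beta> adv"
  shows "(\<forall>t. real (rrw_queued n adv t) \<le> 2 * \<rho> / (1 - \<rho>) * real n + real \<beta>) \<and>
    rrw_latency_at_most n adv ((2 - \<rho>) / (1 - \<rho>)\<^sup>2 * real n + real \<beta> / (1 - \<rho>))"
proof (intro conjI allI)
  fix t
  have "real (rrw_queued n adv t) \<le> \<rho> * real n / (1 - \<rho>) + real \<beta>"
    using rrw_potential_le[OF assms(1-3), of adv t] bucket_backlog_le[OF assms(5), of t]
    by (simp add: rrw_potential_def)
  moreover have "0 \<le> \<rho> * real n / (1 - \<rho>)" using assms by simp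
  moreover have "2 * \<rho> / (1 - \<rho>) * real n = 2 * (\<rho> * real n / (1 - \<rho>))" by simp
  ultimately show "real (rrw_queued n adv t) \<le> 2 * \<rho> / (1 - \<rho>) * real n + real \<beta>"
    by linarith
next
  have "real n \<le> (2 - \<rho>) * real n"
    using assms(3) by (simp add: mult_le_cancel_right1)
  then have "real n / (1 - \<rho>)\<^sup>2 \<le> (2 - \<rho>) * real n / (1 - \<rho>)\<^sup>2"
    by (rule divide_right_mono) simp
  then have "real n / (1 - \<rho>)\<^sup>2 + real \<beta> / (1 - \<rho>) \<le>
      (2 - \<rho>) / (1 - \<rho>)\<^sup>2 * real n + real \<beta> / (1 - \<rho>)"
    by simp
  then show "rrw_latency_at_most n adv ((2 - \<rho>) / (1 - \<rho>)\<^sup>2 * real n + real \<beta> / (1 - \<rho>))"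
    using rrw_latency[OF assms(1-3,5)] unfolding rrw_latency_at_most_def
    by (meson order_trans)
qed

end
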